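(* For every red-blue (RB) graph $G$, $$\sum_{K\preceq G}\omega_{RB}(K)\,e\bigl(\mathfrak r(G/K);\mathbf 1\bigr)=\mathbf b(G).$$ Equivalently, $\omega_{RB}*\widetilde e=\mathbf b$, where $\widetilde e(G)=e(\mathfrak r(G);\mathbf 1)$ and $(f*g)(G)=\sum_{K\preceq G}f(K)g(G/K)$.
   Context: All quivers are finite. A quiver $G=(V_G,E_G,\rho_G)$ consists of finite sets $V_G,E_G$ and a map $\rho_G:E_G\to V_G\times V_G$; $\rho_G(\varepsilon)=(u,v)$ means $\varepsilon$ is directed from $u$ to $v$, written $\varepsilon:u\to v$. Parallel edges, directed cycles and tadpoles (edges $u\to u$) are allowed. Acyclic means without directed cycles (a tadpole is a directed cycle). Each edge $\varepsilon$ carries a parameter $\beta_\varepsilon$ (over a field $\Bbbk$ of characteristic zero); edges surviving in a subquiver or contraction keep their parameters. Put $\beta_{\varepsilon,\pm}=(\beta_\varepsilon\pm1)/2$. A cut-subquiver $K\preceq G$ has vertex set $V_G$ and an arbitrary edge subset $E_K\subseteq E_G$. The contraction $G/K$ has as vertices the connected components of $K$ and as edges $E_G\setminus E_K$ with induced incidences (an edge with both endpoints in one component becomes a tadpole). The function $e$: let $E_{\mathrm{tad}}(G)$ be the set of tadpoles and $G_{\mathrm{pruned}}$ the quiver obtained by deleting all tadpoles. For tadpole-free $G$, $e_0(G)=|\operatorname{LE}(G)|/|V_G|!$ if $G$ is acyclic ($\operatorname{LE}(G)$ = set of linear extensions of the partial order on $V_G$ induced by the edges), and $e_0(G)=0$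 otherwise. In general $e(G;\boldsymbol\beta)=\bigl(\prod_{\varepsilon\in E_{\mathrm{tad}}(G)}(-\beta_{\varepsilon,-})\bigr)e_0(G_{\mathrm{pruned}})$. The function $\omega(\cdot;\boldsymbol\beta)$ is the unique function on quivers with $\sum_{H\preceq G}\omega(H)\,e(G/H)=\epsilon(G)$ for all $G$, where $\epsilon(G)=1$ if $E_G=\emptyset$ and $0$ otherwise. The symbol $\mathbf 1$ in place of $\boldsymbol\beta$ means that all edge parameters are set to $1$. An RB graph is a quiver $G$ (possibly with directed cycles and tadpoles) with a coloring $E_G\to\{r,b\}$ of its edges red or blue; $E_r(G)$, $E_b(G)$ are the sets of red and blue edges and $b(G)=|E_b(G)|$. Cut-subquivers and contractions inherit colors. Define $\omega_{RB}(G)=(-1)^{b(G)}\,\omega(G;\boldsymbol\beta)$ evaluated at $\beta_\varepsilon=1$ for red $\varepsilon$ and $\beta_\varepsilon=-1$ for blue $\varepsilon$. The redification $\mathfrak r(G)$ is the quiver obtained by keeping the orientation of every red edge, reversing the orientation of every blue edge, and forgetting the colors. The pure-blue character is $\mathbf b(G)=1$ if $E_r(G)=\emptyset$ and $\mathbf b(G)=0$ otherwise. *)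

theory Defs
  imports Complex_Main "HOL-Library.FuncSet" "Graph_Theory.Graph_Theory"
begin

text \<open>
  A quiver is a finite directed multigraph with loops, that is, a \<open>pre_digraph\<close> satisfying
  \<^locale>\<open>fin_digraph\<close>; an edge \<open>x\<close> is directed from \<open>tail G x\<close> to \<open>head G x\<close>. Edge parameters and
  colours are functions on the type of edge names. Since subquivers and contractions retain the
  names of the surviving edges, these inherit their parameters and colours.
\<close>

text \<open>
  A spanning subgraph has the incidence functions of the ambient graph, so that
  the cut-subquivers of \<open>G\<close> correspond exactly to the subsets of \<open>arcs G\<close>.
\<close>

abbreviation cut_subquiver :: "('v, 'e) pre_digraph \<Rightarrow> ('v, 'e) pre_digraph \<Rightarrow> bool"
    (infix \<open>\<preceq>\<close> 50) where
  "K \<preceq> G \<equiv> spanning K G"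

text \<open>
  The connected components of \<open>K\<close> ignore the directions of edges: they are the strong components
  of the symmetrisation of \<open>K\<close>, represented as sets of vertices.
\<close>

definition components :: "('v, 'e) pre_digraph \<Rightarrow> 'v set set" where
  "components K = pre_digraph.sccs_verts (with_proj (mk_symmetric K))"

definition component_of :: "('v, 'e) pre_digraph \<Rightarrow> 'v \<Rightarrow> 'v set" where
  "component_of K v = pre_digraph.scc_of (with_proj (mk_symmetric K)) v"

definition contraction :: "('v, 'e) pre_digraph \<Rightarrow> ('v, 'e) pre_digraph \<Rightarrow> ('v set, 'e) pre_digraph"
  where
  "contraction G K =
     \<lparr> verts = components K, arcs = arcs G - arcs K,
       tail = (\<lambda>x. component_of K (tail G x)), head = (\<lambda>x. component_of K (head G x)) \<rparr>"

definition conv ::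
    "(('v, 'e) pre_digraph \<Rightarrow> 'k::field_char_0) \<Rightarrow> (('v set, 'e) pre_digraph \<Rightarrow> 'k) \<Rightarrow>
     ('v, 'e) pre_digraph \<Rightarrow> 'k" where
  "conv f g G = (\<Sum>K | K \<preceq> G. f K * g (contraction G K))"

definition tadpoles :: "('v, 'e) pre_digraph \<Rightarrow> 'e set" where
  "tadpoles G = {x \<in> arcs G. tail G x = head G x}"

definition pruned :: "('v, 'e) pre_digraph \<Rightarrow> ('v, 'e) pre_digraph" where
  "pruned G = G\<lparr>arcs := arcs G - tadpoles G\<rparr>"

text \<open>In \<open>Graph_Theory\<close>, cycles are directed, and loops are cycles.\<close>

definition acyclic_quiver :: "('v, 'e) pre_digraph \<Rightarrow> bool" where
  "acyclic_quiver G \<longleftrightarrow> \<not> (\<exists>p. pre_digraph.cycle G p)"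

definition linear_extensions :: "('v, 'e) pre_digraph \<Rightarrow> ('v \<times> 'v) set set" where
  "linear_extensions G =
     {r. linear_order_on (verts G) r \<and> rtrancl_on (verts G) (arcs_ends G) \<subseteq> r}"

definition e0_fun :: "('v, 'e) pre_digraph \<Rightarrow> 'k::field_char_0" where
  "e0_fun G = (if acyclic_quiver G
     then of_nat (card (linear_extensions G)) / fact (card (verts G)) else 0)"

definition e_fun :: "('e \<Rightarrow> 'k::field_char_0) \<Rightarrow> ('v, 'e) pre_digraph \<Rightarrow> 'k" where
  "e_fun \<beta> G = (\<Prod>x\<in>tadpoles G. - ((\<beta> x - 1) / 2)) * e0_fun (pruned G)"

definition eps_fun :: "('v, 'e) pre_digraph \<Rightarrow> 'k::field_char_0" where
  "eps_fun G = (if arcs G = {} then 1 else 0)"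

text \<open>
  The defining property of \<open>\<omega>\<close>; extensionality fixes the irrelevant values at arguments that are
  not quivers. Unique existence is proved in \<open>ex1_is_omega\<close> below.
\<close>

definition is_omega ::
    "('e \<Rightarrow> 'k::field_char_0) \<Rightarrow> (('v, 'e) pre_digraph \<Rightarrow> 'k) \<Rightarrow> bool" where
  "is_omega \<beta> w \<longleftrightarrow> w \<in> extensional {G. fin_digraph G} \<and>
     (\<forall>G. fin_digraph G \<longrightarrow> (\<Sum>H | H \<preceq> G. w H * e_fun \<beta> (contraction G H)) = eps_fun G)"

definition omega :: "('e \<Rightarrow> 'k::field_char_0) \<Rightarrow> ('v, 'e) pre_digraph \<Rightarrow> 'k" where
  "omega \<beta> = (THE w. is_omega \<beta> w)"


text \<open>An RB graph is given by a quiver \<open>G\<close> together with a colouring \<open>c\<close> of the edge names.\<close>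

datatype colour = Red | Blue

definition red_edges :: "('e \<Rightarrow> colour) \<Rightarrow> ('v, 'e) pre_digraph \<Rightarrow> 'e set" where
  "red_edges c G = {x \<in> arcs G. c x = Red}"

definition blue_edges :: "('e \<Rightarrow> colour) \<Rightarrow> ('v, 'e) pre_digraph \<Rightarrow> 'e set" where
  "blue_edges c G = {x \<in> arcs G. c x = Blue}"

definition colour_param :: "('e \<Rightarrow> colour) \<Rightarrow> 'e \<Rightarrow> 'k::field_char_0" where
  "colour_param c x = (case c x of Red \<Rightarrow> 1 | Blue \<Rightarrow> - 1)"

definition omega_RB :: "('e \<Rightarrow> colour) \<Rightarrow> ('v, 'e) pre_digraph \<Rightarrow> 'k::field_char_0" where
  "omega_RB c G = (- 1) ^ card (blue_edges c G) * omega (colour_param c) G"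

definition redification :: "('e \<Rightarrow> colour) \<Rightarrow> ('v, 'e) pre_digraph \<Rightarrow> ('v, 'e) pre_digraph" where
  "redification c G =
     \<lparr> verts = verts G, arcs = arcs G,
       tail = (\<lambda>x. case c x of Red \<Rightarrow> tail G x | Blue \<Rightarrow> head G x),
       head = (\<lambda>x. case c x of Red \<Rightarrow> head G x | Blue \<Rightarrow> tail G x) \<rparr>"

definition e_tilde :: "('e \<Rightarrow> colour) \<Rightarrow> ('v, 'e) pre_digraph \<Rightarrow> 'k::field_char_0" where
  "e_tilde c G = e_fun (\<lambda>_. 1) (redification c G)"

definition pure_blue :: "('e \<Rightarrow> colour) \<Rightarrow> ('v, 'e) pre_digraph \<Rightarrow> 'k::field_char_0" where
  "pure_blue c G = (if red_edges c G = {} then 1 else 0)"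


subsection \<open>Well-definedness of \<open>\<omega>\<close>\<close>

lemma cut_subquivers_eq:
  assumes "fin_digraph G"
  shows "{K. K \<preceq> G} = (\<lambda>F. G\<lparr>arcs := F\<rparr>) ` Pow (arcs G)"
proof -
  interpret fin_digraph G by (rule assms)
  have "K \<in> (\<lambda>F. G\<lparr>arcs := F\<rparr>) ` Pow (arcs G)" if "K \<preceq> G" for K
  proof (rule image_eqI[where x = "arcs K"])
    show "K = G\<lparr>arcs := arcs K\<rparr>" "arcs K \<in> Pow (arcs G)"
      using that by (cases K; auto simp: spanning_def subgraph_def compatible_def)+
  qed
  moreover have "G\<lparr>arcs := F\<rparr> \<preceq> G" if "F \<subseteq> arcs G" for F
    using that wf_digraph
    by (auto simp: spanning_def subgraph_def compatible_def wf_digraph_def)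
  ultimately show ?thesis by auto
qed

lemma finite_cut_subquivers: "fin_digraph G \<Longrightarrow> finite {K. K \<preceq> G}"
  by (simp add: cut_subquivers_eq fin_digraph.finite_arcs)

lemma fin_digraph_cut_subquiver: "fin_digraph G \<Longrightarrow> K \<preceq> G \<Longrightarrow> fin_digraph K"
  by (auto simp: spanning_def subgraph_def fin_digraph_def fin_digraph_axioms_def
      intro: finite_subset)

lemma cut_subquiver_refl: "fin_digraph G \<Longrightarrow> G \<preceq> G"
  by (simp add: spanning_def subgraph_def compatible_def fin_digraph_def)

lemma card_arcs_cut_subquiver:
  assumes "fin_digraph G" "K \<preceq> G" "K \<noteq> G"
  shows "card (arcs K) < card (arcs G)"
proof -
  have "arcs K \<subseteq> arcs G" "arcs K \<noteq> arcs G"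
    using assms by (auto simp: spanning_def subgraph_def compatible_def)
  then show ?thesis
    using fin_digraph.finite_arcs[OF assms(1)] by (simp add: psubset_card_mono psubsetI)
qed

lemma finite_components:
  assumes "fin_digraph G"
  shows "finite (components G)"
proof -
  have "components G \<subseteq> Pow (verts G)"
    by (auto simp: components_def pre_digraph.sccs_verts_def reachable_def mk_symmetric_def
        dest: in_rtrancl_on_in_F)
  then show ?thesis
    using fin_digraph.finite_verts[OF assms] finite_subset by blast
qed

lemma e_fun_self_neq_0:
  assumes "fin_digraph G"
  shows "e_fun \<beta> (contraction G G) \<noteq> 0"
proof -
  let ?H = "contraction G G"
  have fin: "finite (verts ?H)"
    using finite_components[OF assms] by (simp add: contraction_def)
  have ends: "tadpoles ?H = {}" "pruned ?H = ?H" "arcs_ends ?H = {}" "arcs ?H = {}"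
    by (simp_all add: tadpoles_def pruned_def contraction_def arcs_ends_def)
  have "acyclic_quiver ?H"
    using ends(4) by (auto simp: acyclic_quiver_def pre_digraph.cycle_def pre_digraph.awalk_def)
  have "linear_extensions ?H \<subseteq> Pow (verts ?H \<times> verts ?H)"
    by (auto simp: linear_extensions_def linear_order_on_def partial_order_on_def preorder_on_def)
  then have "finite (linear_extensions ?H)"
    by (rule finite_subset) (simp add: fin)
  moreover obtain r where r: "well_order_on (verts ?H) r"
    using well_order_on by blast
  have "(a, b) \<in> r" if "(a, b) \<in> rtrancl_on (verts ?H) {}" for a b
    using that
  proof cases
    case rtrancl_on_refl
    then show ?thesis
      using r by (auto simp: well_order_on_def linear_order_on_def partial_order_on_def
          preorder_on_def refl_on_def)
  qed auto
  then have "r \<in> linear_extensions ?H"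
    using r ends(3) by (auto simp: linear_extensions_def well_order_on_def)
  ultimately have "card (linear_extensions ?H) \<noteq> 0"
    by auto
  then show ?thesis
    using ends \<open>acyclic_quiver ?H\<close> by (simp add: e_fun_def e0_fun_def)
qed

lemma omega_sum_split:
  fixes w :: "('v, 'e) pre_digraph \<Rightarrow> 'k::field_char_0"
  assumes "fin_digraph G"
  shows "(\<Sum>H | H \<preceq> G. w H * e_fun \<beta> (contraction G H)) =
    w G * e_fun \<beta> (contraction G G) +
    (\<Sum>H | H \<preceq> G \<and> H \<noteq> G. w H * e_fun \<beta> (contraction G H))"
proof -
  have "{H. H \<preceq> G} - {G} = {H. H \<preceq> G \<and> H \<noteq> G}" by auto
  then show ?thesis
    using sum.remove[OF finite_cut_subquivers[OF assms], of G] cut_subquiver_refl[OF assms]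
    by simp
qed

fun omega_aux :: "('e \<Rightarrow> 'k::field_char_0) \<Rightarrow> nat \<Rightarrow> ('v, 'e) pre_digraph \<Rightarrow> 'k" where
  "omega_aux \<beta> 0 G = eps_fun G / e_fun \<beta> (contraction G G)"
| "omega_aux \<beta> (Suc n) G =
     (eps_fun G - (\<Sum>H | H \<preceq> G \<and> H \<noteq> G. omega_aux \<beta> n H * e_fun \<beta> (contraction G H)))
       / e_fun \<beta> (contraction G G)"

lemma omega_aux_stable:
  assumes "fin_digraph G" "card (arcs G) \<le> n"
  shows "omega_aux \<beta> (Suc n) G = omega_aux \<beta> n G"
  using assms
proof (induction n arbitrary: G)
  case 0
  then have "{H. H \<preceq> G \<and> H \<noteq> G} = {}"
    using card_arcs_cut_subquiver by fastforce
  then have "(\<Sum>H | H \<preceq> G \<and> H \<noteq> G. omega_aux \<beta> 0 H * e_fun \<beta> (contraction G H)) = 0"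
    by (metis (no_types, lifting) sum.empty)
  then show ?case by (simp only: omega_aux.simps diff_zero)
next
  case (Suc n)
  have "omega_aux \<beta> (Suc n) H = omega_aux \<beta> n H" if "H \<preceq> G \<and> H \<noteq> G" for H
    using that Suc card_arcs_cut_subquiver[of G H] fin_digraph_cut_subquiver[of G H] by auto
  then have "(\<Sum>H | H \<preceq> G \<and> H \<noteq> G. omega_aux \<beta> (Suc n) H * e_fun \<beta> (contraction G H)) =
      (\<Sum>H | H \<preceq> G \<and> H \<noteq> G. omega_aux \<beta> n H * e_fun \<beta> (contraction G H))"
    by (intro sum.cong refl) (metis (mono_tags, lifting) mem_Collect_eq)
  then show ?case
    by (subst (1 2) omega_aux.simps(2)) presburger
qed

lemma omega_aux_eq:
  assumes "fin_digraph G" "card (arcs G) \<le> n"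
  shows "omega_aux \<beta> n G = omega_aux \<beta> (card (arcs G)) G"
  using assms(2)
proof (induction rule: dec_induct)
  case (step n)
  then show ?case using omega_aux_stable[OF assms(1)] by metis
qed simp

lemma ex_is_omega: "\<exists>w :: ('v, 'e) pre_digraph \<Rightarrow> 'k::field_char_0. is_omega \<beta> w"
proof -
  define w :: "('v, 'e) pre_digraph \<Rightarrow> 'k"
    where "w = restrict (\<lambda>G. omega_aux \<beta> (card (arcs G)) G) {G. fin_digraph G}"
  have "(\<Sum>H | H \<preceq> G. w H * e_fun \<beta> (contraction G H)) = eps_fun G" if G: "fin_digraph G" for G
  proof -
    let ?n = "card (arcs G)"
    have aux: "w H = omega_aux \<beta> ?n H" if "H \<preceq> G \<and> H \<noteq> G" for H
    proof -
      have H: "fin_digraph H" "card (arcs H) \<le> ?n"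
        using that G fin_digraph_cut_subquiver card_arcs_cut_subquiver less_imp_le by blast+
      then show ?thesis using omega_aux_eq[OF H, of \<beta>] by (simp add: w_def)
    qed
    have "w G = omega_aux \<beta> (Suc ?n) G"
      using G omega_aux_stable[OF G order_refl, of \<beta>] by (simp add: w_def)
    also have "\<dots> = (eps_fun G
        - (\<Sum>H | H \<preceq> G \<and> H \<noteq> G. omega_aux \<beta> ?n H * e_fun \<beta> (contraction G H)))
        / e_fun \<beta> (contraction G G)"
      by simp
    also have "(\<Sum>H | H \<preceq> G \<and> H \<noteq> G. omega_aux \<beta> ?n H * e_fun \<beta> (contraction G H)) =
        (\<Sum>H | H \<preceq> G \<and> H \<noteq> G. w H * e_fun \<beta> (contraction G H))"
      by (intro sum.cong refl) (simp add: aux)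
    finally show ?thesis
      using omega_sum_split[OF G, of w \<beta>] e_fun_self_neq_0[OF G, of \<beta>] by (simp add: field_simps)
  qed
  then have "is_omega \<beta> w"
    by (auto simp: is_omega_def w_def)
  then show ?thesis by blast
qed

lemma is_omega_unique:
  fixes w w' :: "('v, 'e) pre_digraph \<Rightarrow> 'k::field_char_0"
  assumes w: "is_omega \<beta> w" and w': "is_omega \<beta> w'"
  shows "w = w'"
proof (rule extensionalityI)
  show "w \<in> extensional {G. fin_digraph G}" "w' \<in> extensional {G. fin_digraph G}"
    using assms by (simp_all add: is_omega_def)
next
  have "w G = w' G" if "fin_digraph G" for G
    using that
  proof (induction "card (arcs G)" arbitrary: G rule: less_induct)
    case less
    have "w H = w' H" if "H \<preceq> G \<and> H \<noteq> G" for H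
      using that less card_arcs_cut_subquiver[of G H] fin_digraph_cut_subquiver[of G H] by auto
    then have "(\<Sum>H | H \<preceq> G \<and> H \<noteq> G. w H * e_fun \<beta> (contraction G H)) =
        (\<Sum>H | H \<preceq> G \<and> H \<noteq> G. w' H * e_fun \<beta> (contraction G H))"
      by (intro sum.cong refl) simp
    moreover have "(\<Sum>H | H \<preceq> G. w H * e_fun \<beta> (contraction G H)) =
        (\<Sum>H | H \<preceq> G. w' H * e_fun \<beta> (contraction G H))"
      using w w' less.prems by (simp add: is_omega_def)
    ultimately show ?case
      using e_fun_self_neq_0[OF less.prems, of \<beta>] omega_sum_split[OF less.prems, of _ \<beta>]
      by simp
  qed
  then show "w G = w' G" if "G \<in> {G. fin_digraph G}" for G
    using that by simp
qed

lemma ex1_is_omega: "\<exists>!w :: ('v, 'e) pre_digraph \<Rightarrow> 'k::field_char_0. is_omega \<beta> w"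
  using ex_is_omega is_omega_unique by (rule ex_ex1I)

lemma is_omega_omega: "is_omega \<beta> (omega \<beta>)"
  unfolding omega_def by (rule theI'[OF ex1_is_omega])

end

theory Submission
  imports Defs
begin

text \<open>
  Up to the factor \<open>1 / |V|!\<close>, the number \<open>e (G; \<beta>)\<close> is a sum over all linear orders on the
  vertices of a product of local edge weights (\<open>e_fun_eq_sum_linear_orders\<close>): an edge with
  distinct ends has weight 1 or 0 according to whether the order respects it, and a tadpole has
  weight \<open>- (\<beta> - 1) / 2\<close>; no order respects a directed cycle through two or more
  vertices, so acyclicity need not be imposed. A reversed blue edge with parameter 1 has weight \<open>1 - w\<close>, where \<open>w\<close> is
  the weight of the original edge with parameter \<open>- 1\<close>, and this is true for tadpoles also.
  Let \<open>R\<close> and \<open>B\<close> be the sets of red and blue edges of \<open>G\<close>, and \<open>G[F]\<close> the cut-subquiver with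
  edge set \<open>F\<close>. Expanding the product of the factors \<open>1 - w\<close> over the blue edges shows that
  \<open>e_tilde G\<close> is the sum of \<open>(- 1)^|S| e (G[R \<union> S]; \<beta>)\<close> over all \<open>S \<subseteq> B\<close>, where \<open>\<beta>\<close> is 1 on
  red and \<open>- 1\<close> on blue edges (\<open>e_tilde_eq_sum_blue_subsets\<close>).

  Apply this to the contractions \<open>G/K\<close> and collect the pairs \<open>(K, S)\<close> by the set \<open>T\<close> of edges
  that lie in \<open>S\<close> or are blue edges of \<open>K\<close>. Restriction to an edge set that contains the edges
  of \<open>K\<close> commutes with contraction by \<open>K\<close>, so the convolution becomes the sum over \<open>T \<subseteq> B\<close> of
  \<open>(- 1)^|T|\<close> times the sum of \<open>\<omega> K * e (G[R \<union> T]/K; \<beta>)\<close> over all \<open>K \<preceq> G[R \<union> T]\<close>. By the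
  defining property of \<open>\<omega>\<close> the inner sum is 1 if \<open>R\<close> and \<open>T\<close> are empty, and 0 otherwise.
\<close>

lemma cas_in_trans:
  assumes "pre_digraph.cas G u p v" "p \<noteq> []" "\<forall>x\<in>set p. (tail G x, head G x) \<in> r" "trans r"
  shows "(u, v) \<in> r"
  using assms(1-3)
proof (induction p arbitrary: u)
  case (Cons x p)
  then have x: "tail G x = u" "(u, head G x) \<in> r" and p: "pre_digraph.cas G (head G x) p v"
    by (auto simp: pre_digraph.cas.simps)
  show ?case
  proof (cases "p = []")
    case True
    then show ?thesis
      using x p by (simp add: pre_digraph.cas.simps)
  next
    case False
    then have "(head G x, v) \<in> r"
      using Cons p by simp
    then show ?thesis
      using x(2) by (rule transD[OF assms(4), rotated])
  qed
qed simp

text \<open>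
  It suffices to respect the edges themselves, because a linear order contains the reflexive
  transitive closure of any relation that it contains.
\<close>

lemma linear_extensions_eq:
  assumes "wf_digraph G"
  shows "linear_extensions G =
    {r. linear_order_on (verts G) r \<and> (\<forall>x\<in>arcs G. (tail G x, head G x) \<in> r)}"
proof -
  have "rtrancl_on (verts G) (arcs_ends G) \<subseteq> r \<longleftrightarrow> (\<forall>x\<in>arcs G. (tail G x, head G x) \<in> r)"
    if r: "linear_order_on (verts G) r" for r
  proof
    have "(tail G x, head G x) \<in> rtrancl_on (verts G) (arcs_ends G)" if "x \<in> arcs G" for x
      using that assms
      by (meson rtrancl_on.intros wf_digraph.in_arcs_imp_in_arcs_ends wf_digraph.tail_in_verts
          wf_digraph.head_in_verts)
    then show "\<forall>x\<in>arcs G. (tail G x, head G x) \<in> r"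
      if "rtrancl_on (verts G) (arcs_ends G) \<subseteq> r"
      using that by blast
  next
    assume arcs: "\<forall>x\<in>arcs G. (tail G x, head G x) \<in> r"
    have "(a, b) \<in> r" if "(a, b) \<in> rtrancl_on (verts G) (arcs_ends G)" for a b
      using that
    proof (induction rule: rtrancl_on_induct)
      case base
      then show ?case
        using r by (auto simp: linear_order_on_def partial_order_on_def preorder_on_def refl_on_def)
    next
      case (step y z)
      then have "(y, z) \<in> r"
        using arcs by (auto simp: arcs_ends_def arc_to_ends_def)
      moreover have "trans r"
        using r by (simp add: linear_order_on_def partial_order_on_def preorder_on_def)
      ultimately show ?case
        using step by (blast dest: transD)
    qed
    then show "rtrancl_on (verts G) (arcs_ends G) \<subseteq> r"
      by auto
  qed
  then show ?thesis
    by (auto simp: linear_extensions_def)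
qed

text \<open>
  Tadpoles must be excluded: every linear order respects them, although they are cycles.
\<close>

lemma linear_extensions_cyclic:
  assumes "wf_digraph G" "tadpoles G = {}" "\<not> acyclic_quiver G"
  shows "linear_extensions G = {}"
proof (rule equals0I)
  fix r
  assume "r \<in> linear_extensions G"
  then have r: "trans r" "antisym r" and arcs: "\<forall>x\<in>arcs G. (tail G x, head G x) \<in> r"
    by (auto simp: linear_extensions_eq[OF assms(1)] linear_order_on_def partial_order_on_def
        preorder_on_def)
  obtain u p where p: "pre_digraph.awalk G u p u" "p \<noteq> []"
    using assms(3) by (auto simp: acyclic_quiver_def pre_digraph.cycle_def)
  then obtain x q where xq: "p = x # q"
    by (cases p) auto
  then have x: "x \<in> arcs G" "tail G x = u" and q: "pre_digraph.cas G (head G x) q u"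
      "set q \<subseteq> arcs G"
    using p by (auto simp: pre_digraph.awalk_def pre_digraph.cas.simps)
  have "head G x \<noteq> u"
    using x assms(2) by (auto simp: tadpoles_def)
  moreover from this have "q \<noteq> []"
    using q by (auto simp: pre_digraph.cas.simps)
  then have "(head G x, u) \<in> r"
    using cas_in_trans[OF q(1) _ _ r(1)] q(2) arcs by auto
  moreover have "(u, head G x) \<in> r"
    using x arcs by auto
  ultimately show False
    using r(2) by (auto dest: antisymD)
qed

lemma e0_fun_eq:
  assumes "wf_digraph G" "tadpoles G = {}"
  shows "e0_fun G = (of_nat (card (linear_extensions G)) / fact (card (verts G)) :: 'k::field_char_0)"
  using linear_extensions_cyclic[OF assms] by (auto simp: e0_fun_def)

text \<open>
  The weight of an edge \<open>x\<close> relative to a linear order \<open>r\<close> on the vertices; tadpoles, which every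
  order respects, carry the parameter-dependent factor of \<open>e\<close>.
\<close>

definition edge_weight ::
    "('e \<Rightarrow> 'k::field_char_0) \<Rightarrow> ('v, 'e) pre_digraph \<Rightarrow> ('v \<times> 'v) set \<Rightarrow> 'e \<Rightarrow> 'k" where
  "edge_weight \<beta> G r x =
     (if tail G x = head G x then - ((\<beta> x - 1) / 2) else of_bool ((tail G x, head G x) \<in> r))"

lemma prod_of_bool: "finite A \<Longrightarrow> (\<Prod>x\<in>A. of_bool (P x)) = (of_bool (\<forall>x\<in>A. P x) :: 'k::field)"
  by (induction A rule: finite_induct) auto

lemma finite_linear_orders:
  assumes "finite V"
  shows "finite {r. linear_order_on V r}"
proof (rule finite_subset)
  show "{r. linear_order_on V r} \<subseteq> Pow (V \<times> V)"
    by (auto simp: linear_order_on_def partial_order_on_def preorder_on_def)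
qed (simp add: assms)

lemma e_fun_eq_sum_linear_orders:
  fixes \<beta> :: "'e \<Rightarrow> 'k::field_char_0"
  assumes "fin_digraph G"
  shows "e_fun \<beta> G =
    (\<Sum>r | linear_order_on (verts G) r. \<Prod>x\<in>arcs G. edge_weight \<beta> G r x) / fact (card (verts G))"
proof -
  interpret fin_digraph G by (rule assms)
  let ?L = "{r. linear_order_on (verts G) r}" and ?P = "pruned G"
  let ?t = "\<Prod>x\<in>tadpoles G. - ((\<beta> x - 1) / 2)"
  have P: "wf_digraph ?P" "tadpoles ?P = {}" "verts ?P = verts G" "arcs ?P = arcs G - tadpoles G"
      "tail ?P = tail G" "head ?P = head G"
    using wf_digraph by (auto simp: pruned_def wf_digraph_def tadpoles_def)
  have "(\<Prod>x\<in>arcs G. edge_weight \<beta> G r x) = ?t * of_bool (r \<in> linear_extensions ?P)"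
    if "r \<in> ?L" for r
  proof -
    have "(\<Prod>x\<in>arcs G. edge_weight \<beta> G r x) =
        (\<Prod>x\<in>arcs G - tadpoles G. edge_weight \<beta> G r x) * (\<Prod>x\<in>tadpoles G. edge_weight \<beta> G r x)"
      by (rule prod.subset_diff) (auto simp: tadpoles_def)
    also have "(\<Prod>x\<in>tadpoles G. edge_weight \<beta> G r x) = ?t"
      by (rule prod.cong) (auto simp: tadpoles_def edge_weight_def)
    also have "(\<Prod>x\<in>arcs G - tadpoles G. edge_weight \<beta> G r x) =
        (\<Prod>x\<in>arcs G - tadpoles G. of_bool ((tail G x, head G x) \<in> r))"
      by (rule prod.cong) (auto simp: tadpoles_def edge_weight_def)
    also have "\<dots> = of_bool (r \<in> linear_extensions ?P)"
      using that P by (simp add: prod_of_bool linear_extensions_eq)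
    finally show ?thesis
      by (simp add: mult.commute)
  qed
  then have "(\<Sum>r\<in>?L. \<Prod>x\<in>arcs G. edge_weight \<beta> G r x) =
      ?t * (\<Sum>r\<in>?L. of_bool (r \<in> linear_extensions ?P))"
    by (simp add: sum_distrib_left)
  also have "(\<Sum>r\<in>?L. of_bool (r \<in> linear_extensions ?P)) =
      (of_nat (card (?L \<inter> linear_extensions ?P)) :: 'k)"
    using finite_linear_orders[OF finite_verts] by (simp add: Int_def)
  also have "?L \<inter> linear_extensions ?P = linear_extensions ?P"
    using P by (auto simp: linear_extensions_def)
  finally show ?thesis
    using P by (simp add: e_fun_def e0_fun_eq)
qed

lemma fin_digraph_restrict_arcs:
  "fin_digraph G \<Longrightarrow> F \<subseteq> arcs G \<Longrightarrow> fin_digraph (G\<lparr>arcs := F\<rparr>)"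
  by (rule fin_digraph_cut_subquiver[of G]) (use cut_subquivers_eq[of G] in auto)

lemma fin_digraph_redification: "fin_digraph G \<Longrightarrow> fin_digraph (redification c G)"
  by (auto simp: fin_digraph_def fin_digraph_axioms_def wf_digraph_def redification_def
      split: colour.split)

lemma arcs_eq_red_Un_blue: "arcs G = red_edges c G \<union> blue_edges c G"
  using colour.nchotomy by (auto simp: red_edges_def blue_edges_def)

text \<open>
  For a linear order \<open>r\<close> on the vertices, weights of red edges are unchanged under redification, and those of blue edges are
  complemented: exactly one orientation of an edge with distinct ends is respected by \<open>r\<close>,
  and a blue tadpole has weight 1 before and 0 after.
\<close>

lemma edge_weight_redification:
  assumes "fin_digraph G" "linear_order_on (verts G) r" "x \<in> arcs G"
  shows "edge_weight (\<lambda>_. 1) (redification c G) r x =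
    (if c x = Red then edge_weight (colour_param c) G r x
     else 1 - edge_weight (colour_param c) G r x :: 'k::field_char_0)"
proof -
  interpret fin_digraph G by (rule assms)
  have "(head G x, tail G x) \<in> r \<longleftrightarrow> (tail G x, head G x) \<notin> r" if "tail G x \<noteq> head G x"
    using that assms(2) tail_in_verts[OF assms(3)] head_in_verts[OF assms(3)]
    by (auto simp: linear_order_on_def partial_order_on_def total_on_def dest: antisymD)
  then show ?thesis
    by (cases "c x") (auto simp: edge_weight_def redification_def colour_param_def)
qed

lemma e_tilde_eq_sum_blue_subsets:
  assumes "fin_digraph G"
  shows "e_tilde c G = (\<Sum>S\<in>Pow (blue_edges c G). (-1) ^ card S *
    (e_fun (colour_param c) (G\<lparr>arcs := red_edges c G \<union> S\<rparr>) :: 'k::field_char_0))"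
proof -
  interpret fin_digraph G by (rule assms)
  let ?L = "{r. linear_order_on (verts G) r}" and ?R = "red_edges c G" and ?B = "blue_edges c G"
  let ?n = "fact (card (verts G)) :: 'k"
  let ?w = "edge_weight (colour_param c) G :: _ \<Rightarrow> _ \<Rightarrow> 'k"
  have fin: "finite ?R" "finite ?B" and disj: "?R \<inter> ?B = {}"
    by (auto simp: red_edges_def blue_edges_def)
  have e_restrict: "e_fun (colour_param c) (G\<lparr>arcs := ?R \<union> S\<rparr>) =
      (\<Sum>r\<in>?L. (\<Prod>x\<in>?R. ?w r x) * (\<Prod>x\<in>S. ?w r x)) / ?n" if "S \<subseteq> ?B" for S
  proof -
    have S: "finite S" "?R \<inter> S = {}"
      using that fin disj by (auto intro: finite_subset)
    have "fin_digraph (G\<lparr>arcs := ?R \<union> S\<rparr>)"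
      using that arcs_eq_red_Un_blue[of G c] by (intro fin_digraph_restrict_arcs assms) auto
    moreover have "edge_weight (colour_param c) (G\<lparr>arcs := ?R \<union> S\<rparr>) = ?w"
      by (auto simp: edge_weight_def fun_eq_iff)
    ultimately show ?thesis
      using fin S by (simp add: e_fun_eq_sum_linear_orders prod.union_disjoint)
  qed
  have prods: "(\<Prod>x\<in>arcs G. edge_weight (\<lambda>_. 1) (redification c G) r x) =
      (\<Prod>x\<in>?R. ?w r x) * (\<Prod>x\<in>?B. 1 - ?w r x)" if r: "r \<in> ?L" for r
  proof -
    have w: "edge_weight (\<lambda>_. 1) (redification c G) r x = (if c x = Red then ?w r x else 1 - ?w r x)"
      if "x \<in> arcs G" for x
      using r by (intro edge_weight_redification assms that) simp
    have "(\<Prod>x\<in>arcs G. edge_weight (\<lambda>_. 1) (redification c G) r x) =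
        (\<Prod>x\<in>?R. edge_weight (\<lambda>_. 1) (redification c G) r x) *
        (\<Prod>x\<in>?B. edge_weight (\<lambda>_. 1) (redification c G) r x)"
      using fin disj by (simp add: arcs_eq_red_Un_blue[of G c] prod.union_disjoint)
    also have "(\<Prod>x\<in>?R. edge_weight (\<lambda>_. 1) (redification c G) r x) = (\<Prod>x\<in>?R. ?w r x)"
      by (rule prod.cong) (auto simp: red_edges_def w)
    also have "(\<Prod>x\<in>?B. edge_weight (\<lambda>_. 1) (redification c G) r x) = (\<Prod>x\<in>?B. 1 - ?w r x)"
      by (rule prod.cong) (auto simp: blue_edges_def w)
    finally show ?thesis .
  qed
  have "e_tilde c G =
      (\<Sum>r\<in>?L. \<Prod>x\<in>arcs G. edge_weight (\<lambda>_. 1) (redification c G) r x) / ?n"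
    using e_fun_eq_sum_linear_orders[OF fin_digraph_redification[OF assms, of c]]
    by (simp add: e_tilde_def redification_def)
  also have "\<dots> = (\<Sum>r\<in>?L. (\<Prod>x\<in>?R. ?w r x) * (\<Prod>x\<in>?B. 1 - ?w r x)) / ?n"
    by (simp add: prods)
  also have "\<dots> = (\<Sum>r\<in>?L. \<Sum>S\<in>Pow ?B. (-1) ^ card S * ((\<Prod>x\<in>?R. ?w r x) * (\<Prod>x\<in>S. ?w r x))) / ?n"
    using fin by (simp add: prod_diff_conv_sum sum_distrib_left mult.left_commute)
  also have "\<dots> =
      (\<Sum>S\<in>Pow ?B. (-1) ^ card S * ((\<Sum>r\<in>?L. (\<Prod>x\<in>?R. ?w r x) * (\<Prod>x\<in>S. ?w r x)) / ?n))"
    by (subst sum.swap) (simp add: sum_distrib_left sum_divide_distrib)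
  also have "\<dots> = (\<Sum>S\<in>Pow ?B. (-1) ^ card S *
      e_fun (colour_param c) (G\<lparr>arcs := ?R \<union> S\<rparr>))"
    by (rule sum.cong) (auto simp: e_restrict)
  finally show ?thesis .
qed

lemma fin_digraph_contraction:
  assumes "fin_digraph G" "K \<preceq> G"
  shows "fin_digraph (contraction G K)"
proof -
  interpret G: fin_digraph G by (rule assms)
  interpret K: fin_digraph K using assms by (rule fin_digraph_cut_subquiver)
  interpret S: pair_fin_digraph "mk_symmetric K" by (rule K.pair_fin_digraph_mk_symmetric)
  have "component_of K v \<in> components K" if "v \<in> verts G" for v
    unfolding component_of_def components_def
    using that assms(2) by (intro S.scc_of_in_sccs_verts) (simp add: spanning_def)
  then show ?thesis
    by unfold_locales (auto simp: contraction_def finite_components K.fin_digraph_axioms)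
qed

lemma sum_cut_subquivers:
  assumes "fin_digraph G"
  shows "(\<Sum>K | K \<preceq> G. f K) = (\<Sum>A\<in>Pow (arcs G). f (G\<lparr>arcs := A\<rparr>))"
proof -
  have "inj_on (\<lambda>A. G\<lparr>arcs := A\<rparr>) (Pow (arcs G))"
    by (rule inj_on_inverseI[of _ arcs]) simp
  then show ?thesis
    by (simp add: cut_subquivers_eq[OF assms] sum.reindex)
qed

lemma conv_omega_RB_e_tilde:
  fixes c :: "'e \<Rightarrow> colour" and G :: "('v, 'e) pre_digraph"
  assumes "fin_digraph G"
  shows "conv (omega_RB c) (e_tilde c) G = (pure_blue c G :: 'k::field_char_0)"
proof -
  interpret fin_digraph G by (rule assms)
  let ?R = "red_edges c G" and ?B = "blue_edges c G"
  let ?\<beta> = "colour_param c :: 'e \<Rightarrow> 'k"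
  let ?G = "\<lambda>F. G\<lparr>arcs := F\<rparr>"
  have fin: "finite ?R" "finite ?B" and disj: "?R \<inter> ?B = {}"
    by (auto simp: red_edges_def blue_edges_def)
  have is_omega: "is_omega ?\<beta> (omega ?\<beta> :: ('v, 'e) pre_digraph \<Rightarrow> 'k)"
    by (rule is_omega_omega)
  have arcs: "arcs G = ?R \<union> ?B"
    by (rule arcs_eq_red_Un_blue)
  let ?h = "\<lambda>T A. (-1) ^ card T * (omega ?\<beta> (?G A) * e_fun ?\<beta> (contraction (?G (?R \<union> T)) (?G A)))"
  have summand: "omega_RB c (?G A) * e_tilde c (contraction G (?G A)) =
      (\<Sum>S\<in>Pow (?B - A). ?h ((A \<inter> ?B) \<union> S) A)" if A: "A \<subseteq> arcs G" for A
  proof -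
    let ?C = "contraction G (?G A)"
    have "?G A \<preceq> G"
      using A cut_subquivers_eq[OF assms] by auto
    then have C: "fin_digraph ?C"
      using assms by (rule fin_digraph_contraction[rotated])
    have edges: "red_edges c ?C = ?R - A" "blue_edges c ?C = ?B - A" "blue_edges c (?G A) = A \<inter> ?B"
      using A by (auto simp: red_edges_def blue_edges_def contraction_def)
    \<comment> \<open>Passing from \<open>S\<close> to \<open>T = (A \<inter> B) \<union> S\<close>: the signs multiply, and contracting after
      restriction is the same as restricting after contraction.\<close>
    have expand: "(-1) ^ card (A \<inter> ?B) * omega ?\<beta> (?G A) *
        ((-1) ^ card S * e_fun ?\<beta> (?C\<lparr>arcs := (?R - A) \<union> S\<rparr>)) = ?h ((A \<inter> ?B) \<union> S) A"
      if S: "S \<in> Pow (?B - A)" for S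
    proof -
      have "card ((A \<inter> ?B) \<union> S) = card (A \<inter> ?B) + card S"
        using S fin by (intro card_Un_disjoint) (auto intro: finite_subset)
      moreover have "(?R - A) \<union> S = ?R \<union> ((A \<inter> ?B) \<union> S) - A"
        using S by auto
      then have "?C\<lparr>arcs := (?R - A) \<union> S\<rparr> = contraction (?G (?R \<union> ((A \<inter> ?B) \<union> S))) (?G A)"
        by (simp add: contraction_def)
      ultimately show ?thesis
        by (simp add: power_add mult_ac)
    qed
    have "omega_RB c (?G A) * e_tilde c ?C = (\<Sum>S\<in>Pow (?B - A). (-1) ^ card (A \<inter> ?B) *
        omega ?\<beta> (?G A) * ((-1) ^ card S * e_fun ?\<beta> (?C\<lparr>arcs := (?R - A) \<union> S\<rparr>)))"
      by (simp only: omega_RB_def e_tilde_eq_sum_blue_subsets[OF C] edges sum_distrib_left)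
    also have "\<dots> = (\<Sum>S\<in>Pow (?B - A). ?h ((A \<inter> ?B) \<union> S) A)"
      by (rule sum.cong[OF refl expand])
    finally show ?thesis .
  qed
  have "conv (omega_RB c) (e_tilde c) G = (\<Sum>A\<in>Pow (arcs G). \<Sum>S\<in>Pow (?B - A). ?h ((A \<inter> ?B) \<union> S) A)"
    by (simp add: conv_def sum_cut_subquivers[OF assms] summand)
  also have "\<dots> = (\<Sum>(A, S)\<in>(SIGMA A:Pow (arcs G). Pow (?B - A)). ?h ((A \<inter> ?B) \<union> S) A)"
    using fin by (intro sum.Sigma) auto
  also have "\<dots> = (\<Sum>(T, A)\<in>(SIGMA T:Pow ?B. Pow (?R \<union> T)). ?h T A)"
    by (rule sum.reindex_bij_witness[of _ "\<lambda>(T, A). (A, T - A)" "\<lambda>(A, S). ((A \<inter> ?B) \<union> S, A)"])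
      (use arcs disj in auto)
  also have "\<dots> = (\<Sum>T\<in>Pow ?B. \<Sum>A\<in>Pow (?R \<union> T). ?h T A)"
    using fin by (intro sum.Sigma[symmetric]) (auto intro: finite_subset)
  also have "\<dots> = (\<Sum>T\<in>Pow ?B. if T = {} then pure_blue c G else 0)"
  proof (rule sum.cong[OF refl])
    fix T
    assume T: "T \<in> Pow ?B"
    have GT: "fin_digraph (?G (?R \<union> T))"
      using T arcs by (intro fin_digraph_restrict_arcs[OF assms]) auto
    have "(\<Sum>A\<in>Pow (?R \<union> T). ?h T A) = (-1) ^ card T *
        (\<Sum>H | H \<preceq> ?G (?R \<union> T). omega ?\<beta> H * e_fun ?\<beta> (contraction (?G (?R \<union> T)) H))"
      by (simp add: sum_cut_subquivers[OF GT] sum_distrib_left)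
    also have "\<dots> = (-1) ^ card T * eps_fun (?G (?R \<union> T))"
      using is_omega GT by (simp add: is_omega_def)
    also have "\<dots> = (if T = {} then pure_blue c G else 0)"
      by (auto simp: eps_fun_def pure_blue_def)
    finally show "(\<Sum>A\<in>Pow (?R \<union> T). ?h T A) = (if T = {} then pure_blue c G else 0)" .
  qed
  also have "\<dots> = pure_blue c G"
    using fin by (simp add: sum.delta)
  finally show ?thesis .
qed

theorem theorem8p5:
  fixes G :: "('v, 'e) pre_digraph" and c :: "'e \<Rightarrow> colour"
  assumes "fin_digraph G"
  shows "(\<Sum>K | K \<preceq> G. omega_RB c K * e_fun (\<lambda>_. 1) (redification c (contraction G K)))
           = (pure_blue c G :: 'k::field_char_0)
       \<and> conv (omega_RB c) (e_tilde c) G = (pure_blue c G :: 'k)"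
  using conv_omega_RB_e_tilde[OF assms, of c, where ?'k = 'k] by (simp add: conv_def e_tilde_def)

end
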